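(* Let $G$ be an induced unit-distance graph. Then there exists a regular induced unit-distance graph $H$ such that $G$ is (isomorphic to) a subgraph of $H$.
   Context: $G(\mathbb{R}^2,1)$ denotes the graph with vertex set $\mathbb{R}^2$ in which two points are adjacent if and only if their Euclidean distance is exactly $1$. A graph is an induced unit-distance graph if it is isomorphic to an induced subgraph of $G(\mathbb{R}^2,1)$, i.e. it can be drawn with vertices at distinct points of the plane so that two vertices are at distance exactly $1$ if and only if they are adjacent. A graph is regular if all its vertices have the same degree. *)

theory Defs
  imports "HOL-Analysis.Analysis" "HOL-Library.Equipollence"
begin

record 'a ugraph =
  verts :: "'a set"
  edges :: "'a set set"

definition simple_graph :: "'a ugraph \<Rightarrow> bool" where
  "simple_graph G \<longleftrightarrow> (\<forall>e\<in>edges G. e \<subseteq> verts G \<and> card e = 2)"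

definition adjacent :: "'a ugraph \<Rightarrow> 'a \<Rightarrow> 'a \<Rightarrow> bool" where
  "adjacent G u v \<longleftrightarrow> {u, v} \<in> edges G"

definition neighbours :: "'a ugraph \<Rightarrow> 'a \<Rightarrow> 'a set" where
  "neighbours G v = {u \<in> verts G. adjacent G v u}"

text \<open>Degrees are compared as cardinals, because \<^const>\<open>card\<close> would identify infinite degrees
  with 0. If all degrees are finite, this is equality of \<^const>\<open>card\<close>.\<close>

definition regular_graph :: "'a ugraph \<Rightarrow> bool" where
  "regular_graph G \<longleftrightarrow> (\<forall>u\<in>verts G. \<forall>v\<in>verts G. neighbours G u \<approx> neighbours G v)"

definition subgraph :: "'a ugraph \<Rightarrow> 'a ugraph \<Rightarrow> bool" where
  "subgraph K G \<longleftrightarrow> simple_graph K \<and> verts K \<subseteq> verts G \<and> edges K \<subseteq> edges G"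

definition induced_subgraph :: "'a ugraph \<Rightarrow> 'a ugraph \<Rightarrow> bool" where
  "induced_subgraph K G \<longleftrightarrow> verts K \<subseteq> verts G \<and> edges K = {e \<in> edges G. e \<subseteq> verts K}"

definition isomorphic_graphs :: "'a ugraph \<Rightarrow> 'b ugraph \<Rightarrow> bool" where
  "isomorphic_graphs G H \<longleftrightarrow> (\<exists>f. bij_betw f (verts G) (verts H) \<and>
     (\<forall>u\<in>verts G. \<forall>v\<in>verts G. adjacent G u v \<longleftrightarrow> adjacent H (f u) (f v)))"

definition unit_distance_plane :: "(real ^ 2) ugraph" where
  "unit_distance_plane = \<lparr>verts = UNIV, edges = {{x, y} | x y. dist x y = 1}\<rparr>"

definition induced_unit_distance_graph :: "'a ugraph \<Rightarrow> bool" where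
  "induced_unit_distance_graph G \<longleftrightarrow> simple_graph G \<and>
     (\<exists>K. induced_subgraph K unit_distance_plane \<and> isomorphic_graphs G K)"

lemma adjacent_unit_distance_plane: "adjacent unit_distance_plane x y \<longleftrightarrow> dist x y = 1"
  by (auto simp: adjacent_def unit_distance_plane_def doubleton_eq_iff dist_commute)

lemma simple_graph_unit_distance_plane: "simple_graph unit_distance_plane"
proof -
  have "x \<noteq> y" if "dist x y = 1" for x y :: "real ^ 2"
    using that by auto
  then show ?thesis
    by (auto simp: simple_graph_def unit_distance_plane_def)
qed

lemma induced_unit_distance_graph_iff_drawing:
  "induced_unit_distance_graph G \<longleftrightarrow> simple_graph G \<and>
     (\<exists>p :: 'a \<Rightarrow> real ^ 2. inj_on p (verts G) \<and>
        (\<forall>u\<in>verts G. \<forall>v\<in>verts G. dist (p u) (p v) = 1 \<longleftrightarrow> adjacent G u v))"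
  (is "_ \<longleftrightarrow> _ \<and> ?D")
proof -
  have "(\<exists>K. induced_subgraph K unit_distance_plane \<and> isomorphic_graphs G K) \<longleftrightarrow> ?D"
  proof
    assume "\<exists>K. induced_subgraph K unit_distance_plane \<and> isomorphic_graphs G K"
    then obtain K f where K: "induced_subgraph K unit_distance_plane"
      and f: "bij_betw f (verts G) (verts K)"
        "\<forall>u\<in>verts G. \<forall>v\<in>verts G. adjacent G u v \<longleftrightarrow> adjacent K (f u) (f v)"
      unfolding isomorphic_graphs_def by blast
    have "adjacent K x y \<longleftrightarrow> dist x y = 1" if "x \<in> verts K" "y \<in> verts K" for x y
      using K that adjacent_unit_distance_plane[of x y]
      by (auto simp: induced_subgraph_def adjacent_def)
    moreover have "f u \<in> verts K" if "u \<in> verts G" for u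
      using f(1) that by (rule bij_betwE[rule_format])
    ultimately show ?D
      using f by (intro exI[of _ f]) (simp add: bij_betw_imp_inj_on)
  next
    assume ?D
    then obtain p :: "'a \<Rightarrow> real ^ 2" where p: "inj_on p (verts G)"
      "\<forall>u\<in>verts G. \<forall>v\<in>verts G. dist (p u) (p v) = 1 \<longleftrightarrow> adjacent G u v"
      by blast
    define K where "K = \<lparr>verts = p ` verts G,
      edges = {e \<in> edges unit_distance_plane. e \<subseteq> p ` verts G}\<rparr>"
    have "induced_subgraph K unit_distance_plane"
      by (auto simp: K_def induced_subgraph_def unit_distance_plane_def)
    moreover have "adjacent K (p u) (p v) \<longleftrightarrow> dist (p u) (p v) = 1"
      if "u \<in> verts G" "v \<in> verts G" for u v
      using that adjacent_unit_distance_plane[of "p u" "p v"] by (auto simp: K_def adjacent_def)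
    then have "isomorphic_graphs G K"
      unfolding isomorphic_graphs_def using p
      by (intro exI[of _ p]) (auto simp: K_def bij_betw_def)
    ultimately show "\<exists>K. induced_subgraph K unit_distance_plane \<and> isomorphic_graphs G K"
      by blast
  qed
  then show ?thesis
    by (simp add: induced_unit_distance_graph_def)
qed

end

theory Submission
  imports Defs
begin

text \<open>If \<open>G\<close> is infinite, the whole plane serves as \<open>H\<close>. If \<open>G\<close> is finite, fix an odd \<open>d\<close> that is at
  least its maximum degree and raise the degree of each deficient vertex \<open>v\<close> separately, by gluing
  to \<open>v\<close> a gadget: a finite point set in which one vertex has a prescribed degree \<open>m\<close> and all others
  have degree \<open>d\<close>. A generic rotation of the gadget about \<open>v\<close> creates no accidental unit distances.
  Gadgets for \<open>d\<close> come from gadgets for \<open>d - 1\<close>: in a small graph with a root of degree 2 whose other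
  vertices are perfectly matched, with equal degrees in each matched pair, glue the product of a
  gadget for \<open>d - 1\<close> and an edge to every matching edge. A triangle works for even \<open>d\<close>, a subdivided
  triangular prism for odd \<open>d\<close>. Gadgets with a common root can be superimposed, so all even root
  degrees occur; for odd \<open>d\<close> a root of degree \<open>d - 1\<close> with a pendant edge gives root degree 1.\<close>

section \<open>Point sets with a root of prescribed degree\<close>

text \<open>The plane is taken as \<open>complex\<close>, so that a rotation about the origin is
  multiplication by a number of modulus 1.\<close>

definition unit_degree :: "complex set \<Rightarrow> complex \<Rightarrow> nat" where
  "unit_degree A x = card {y \<in> A. dist x y = 1}"

text \<open>The root is normalised to 0, the fixed point of all rotations, so that
  \<open>z \<mapsto> y + u * z\<close> moves it to \<open>y\<close>.\<close>

definition gadget :: "nat \<Rightarrow> nat \<Rightarrow> bool" where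
  "gadget d m \<longleftrightarrow> (\<exists>Z. finite Z \<and> 0 \<in> Z \<and> unit_degree Z 0 = m \<and>
     (\<forall>z\<in>Z - {0}. unit_degree Z z = d))"

section \<open>Generic rotations and gluing\<close>

text \<open>The circle with centre \<open>a\<close> and radius \<open>cmod b\<close> is not
  concentric with the circle of radius \<open>r\<close> about 0, so they share at most two points.
  In coordinates: the equation fixes \<open>Re (c * u)\<close>, and
  \<open>cmod (c * u) = cmod c\<close> then fixes the imaginary part up to sign.\<close>

lemma finite_unit_rotations_onto_circle:
  fixes a b :: complex
  assumes "a \<noteq> 0" "b \<noteq> 0"
  shows "finite {u. cmod u = 1 \<and> cmod (a + u * b) = r}"
proof -
  define c where "c = cnj a * b"
  define k where "k = (r\<^sup>2 - (cmod a)\<^sup>2 - (cmod b)\<^sup>2) / 2"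
  define t where "t = sqrt ((cmod c)\<^sup>2 - k\<^sup>2)"
  have c: "c \<noteq> 0"
    using assms by (simp add: c_def)
  have "u \<in> {Complex k t / c, Complex k (- t) / c}" if u: "cmod u = 1" "cmod (a + u * b) = r" for u
  proof -
    have "r\<^sup>2 = (cmod a)\<^sup>2 + (cmod (u * b))\<^sup>2 + 2 * Re (c * u)"
      unfolding u(2)[symmetric] c_def cmod_power2 by (simp add: power2_eq_square algebra_simps)
    then have re: "Re (c * u) = k"
      by (simp add: k_def norm_mult u(1))
    have "(cmod (c * u))\<^sup>2 = (cmod c)\<^sup>2"
      by (simp add: norm_mult u(1))
    then have "(Im (c * u))\<^sup>2 = (cmod c)\<^sup>2 - k\<^sup>2"
      using re by (simp add: cmod_power2)
    then have "\<bar>Im (c * u)\<bar> = t"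
      unfolding t_def by (metis real_sqrt_abs)
    then have "c * u = Complex k t \<or> c * u = Complex k (- t)"
      using re by (auto simp: complex_eq_iff abs_if split: if_splits)
    then show ?thesis
      using c by (auto simp: field_simps)
  qed
  then have "{u. cmod u = 1 \<and> cmod (a + u * b) = r} \<subseteq> {Complex k t / c, Complex k (- t) / c}"
    by blast
  then show ?thesis
    by (rule finite_subset) simp
qed

lemma infinite_unit_circle: "infinite {u. cmod u = 1}"
proof
  assume "finite {u. cmod u = 1}"
  moreover have "(\<lambda>x. Complex x (sqrt (1 - x\<^sup>2))) ` {0..1} \<subseteq> {u. cmod u = 1}"
    by (auto simp: cmod_def abs_square_le_1)
  ultimately have "finite ((\<lambda>x. Complex x (sqrt (1 - x\<^sup>2))) ` {0..1})"
    using finite_subset by blast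
  then have "finite {0..1::real}"
    by (rule finite_imageD) (auto simp: inj_on_def)
  then show False
    using infinite_Icc[of 0 "1::real"] by simp
qed

text \<open>Each pair \<open>(a, b)\<close> excludes only finitely many points of the infinite unit
  circle: radius 0 stands for coinciding points, radius 1 for an accidental unit distance.\<close>

lemma exists_generic_rotation:
  fixes A B :: "complex set"
  assumes "finite A" "finite B" "0 \<notin> A" "0 \<notin> B"
  obtains u where "cmod u = 1"
    "\<And>a b. a \<in> A \<Longrightarrow> b \<in> B \<Longrightarrow> a + u * b \<noteq> 0 \<and> cmod (a + u * b) \<noteq> 1"
proof -
  define bad where "bad = (\<Union>a\<in>A. \<Union>b\<in>B. \<Union>r\<in>{0, 1}. {u. cmod u = 1 \<and> cmod (a + u * b) = r})"
  have "finite bad"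
    unfolding bad_def using assms
    by (intro finite_UN_I finite_unit_rotations_onto_circle) auto
  then have "\<not> {u. cmod u = 1} \<subseteq> bad"
    using infinite_unit_circle finite_subset by blast
  then obtain u where "cmod u = 1" "u \<notin> bad"
    by blast
  then show thesis
    by (intro that[of u]) (auto simp: bad_def)
qed

text \<open>For a generic rotation \<open>u\<close> the map \<open>(y, z) \<mapsto> y + u z\<close> embeds the Cartesian product of two
  unit-distance graphs. Gluing a copy of \<open>Z\<close> to every vertex of \<open>B\<close> therefore gives the subgraph of
  \<open>S \<box> Z\<close> induced by \<open>S \<times> {0} \<union> B \<times> Z\<close>.\<close>

lemma glue_gadgets:
  assumes S: "finite S" and B: "B \<subseteq> S" and "gadget d m"
    and r: "\<And>b. b \<in> B \<Longrightarrow> unit_degree B b = r"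
  obtains T where "finite T" "S \<subseteq> T"
    "\<And>x. x \<in> B \<Longrightarrow> unit_degree T x = unit_degree S x + m"
    "\<And>x. x \<in> S - B \<Longrightarrow> unit_degree T x = unit_degree S x"
    "\<And>x. x \<in> T - S \<Longrightarrow> unit_degree T x = d + r"
proof -
  from \<open>gadget d m\<close> obtain Z where Z: "finite Z" "0 \<in> Z" "unit_degree Z 0 = m"
    "\<And>z. z \<in> Z - {0} \<Longrightarrow> unit_degree Z z = d"
    unfolding gadget_def by blast
  \<comment> \<open>Zero differences are left out: pairs that agree in one coordinate are the ones
    that may form edges of the product.\<close>
  define diffs :: "complex set \<Rightarrow> complex set"
    where "diffs X = (\<lambda>(x, y). x - y) ` (X \<times> X) - {0}" for X
  have "finite (diffs S)" "finite (diffs Z)" "0 \<notin> diffs S" "0 \<notin> diffs Z"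
    using S Z by (auto simp: diffs_def)
  then obtain u where u: "cmod u = 1"
    and gen: "\<And>a b. a \<in> diffs S \<Longrightarrow> b \<in> diffs Z \<Longrightarrow> a + u * b \<noteq> 0 \<and> cmod (a + u * b) \<noteq> 1"
    using exists_generic_rotation by metis
  define f where "f = (\<lambda>(y, z). y + u * z)"
  define I where "I = S \<times> {0} \<union> B \<times> Z"
  have I: "I \<subseteq> S \<times> Z" "finite I"
    using B Z S by (auto simp: I_def finite_subset)
  have f_diff: "f (y, z) - f (y', z') = (y - y') + u * (z - z')" for y z y' z'
    by (simp add: f_def algebra_simps)
  have generic: "f (y, z) \<noteq> f (y', z') \<and> dist (f (y, z)) (f (y', z')) \<noteq> 1"
    if "y \<in> S" "y' \<in> S" "z \<in> Z" "z' \<in> Z" "y \<noteq> y'" "z \<noteq> z'" for y z y' z'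
  proof -
    have "y - y' \<in> diffs S" "z - z' \<in> diffs Z"
      using that by (auto simp: diffs_def)
    from gen[OF this] show ?thesis
      by (metis dist_norm f_diff right_minus_eq)
  qed
  have u0: "u \<noteq> 0"
    using u by auto
  have inj: "inj_on f (S \<times> Z)"
  proof (rule inj_onI)
    fix p p' assume "p \<in> S \<times> Z" "p' \<in> S \<times> Z" and eq: "f p = f p'"
    then obtain y z y' z' where p: "p = (y, z)" "p' = (y', z')"
      and *: "y \<in> S" "z \<in> Z" "y' \<in> S" "z' \<in> Z" by auto
    with generic[of y y' z z'] eq have "y = y' \<or> z = z'" by auto
    then show "p = p'"
      using eq u0 by (auto simp: p f_def)
  qed
  \<comment> \<open>If one coordinate agrees, \<open>f_diff\<close> leaves
    \<open>u * (z - z')\<close> or \<open>y - y'\<close>, whose length is the distance within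
    \<open>Z\<close> or \<open>S\<close>. All other pairs are ruled out by genericity.\<close>
  have dist_f: "dist (f (y, z)) (f (y', z')) = 1 \<longleftrightarrow>
      y = y' \<and> dist z z' = 1 \<or> z = z' \<and> dist y y' = 1"
    if "y \<in> S" "y' \<in> S" "z \<in> Z" "z' \<in> Z" for y z y' z'
  proof (cases "y = y' \<or> z = z'")
    case True
    then show ?thesis
      using u by (auto simp: dist_norm f_diff norm_mult)
  next
    case False
    then show ?thesis
      using generic[of y y' z z'] that by auto
  qed
  define T where "T = f ` I"
  have deg: "unit_degree T (f (y, z)) =
      card {z' \<in> Z. (y, z') \<in> I \<and> dist z z' = 1} + card {y' \<in> S. (y', z) \<in> I \<and> dist y y' = 1}"
    if yz: "(y, z) \<in> I" for y z
  proof -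
    let ?A = "{z' \<in> Z. (y, z') \<in> I \<and> dist z z' = 1}"
    let ?B = "{y' \<in> S. (y', z) \<in> I \<and> dist y y' = 1}"
    have yz': "y \<in> S" "z \<in> Z"
      using yz I by auto
    have "{x \<in> T. dist (f (y, z)) x = 1} = f ` (Pair y ` ?A \<union> (\<lambda>y'. (y', z)) ` ?B)"
    proof (intro equalityI subsetI)
      fix x assume "x \<in> {x \<in> T. dist (f (y, z)) x = 1}"
      then obtain y' z' where x: "x = f (y', z')" "(y', z') \<in> I" "dist (f (y, z)) (f (y', z')) = 1"
        by (auto simp: T_def)
      then have "y' \<in> S" "z' \<in> Z"
        using I by auto
      with x dist_f[of y y' z z'] yz' show "x \<in> f ` (Pair y ` ?A \<union> (\<lambda>y'. (y', z)) ` ?B)"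
        by auto
    next
      fix x assume "x \<in> f ` (Pair y ` ?A \<union> (\<lambda>y'. (y', z)) ` ?B)"
      then obtain y' z' where x: "x = f (y', z')" "(y', z') \<in> I"
        "y = y' \<and> dist z z' = 1 \<or> z = z' \<and> dist y y' = 1"
        by auto
      then have "y' \<in> S" "z' \<in> Z"
        using I by auto
      with x dist_f[of y y' z z'] yz' show "x \<in> {x \<in> T. dist (f (y, z)) x = 1}"
        by (auto simp: T_def)
    qed
    moreover have "inj_on f (Pair y ` ?A \<union> (\<lambda>y'. (y', z)) ` ?B)"
      using I yz' by (intro inj_on_subset[OF inj]) auto
    moreover have "card (Pair y ` ?A \<union> (\<lambda>y'. (y', z)) ` ?B)
        = card (Pair y ` ?A) + card ((\<lambda>y'. (y', z)) ` ?B)"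
      using S Z(1) by (intro card_Un_disjoint) auto
    moreover have "card (Pair y ` ?A) = card ?A" "card ((\<lambda>y'. (y', z)) ` ?B) = card ?B"
      by (intro card_image inj_onI; simp)+
    ultimately show ?thesis
      by (simp only: unit_degree_def card_image)
  qed
  show thesis
  proof
    show "finite T"
      using I by (simp add: T_def)
    have f0: "f (y, 0) = y" for y
      by (simp add: f_def)
    show "S \<subseteq> T"
    proof
      fix y assume "y \<in> S"
      then have "f (y, 0) \<in> T"
        unfolding T_def by (intro imageI) (simp add: I_def)
      then show "y \<in> T"
        by (simp add: f0)
    qed
    have S0: "{y' \<in> S. (y', 0) \<in> I \<and> dist y y' = 1} = {y' \<in> S. dist y y' = 1}" for y
      by (auto simp: I_def)
    show "unit_degree T x = unit_degree S x + m" if "x \<in> B" for x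
    proof -
      have mem: "(x, 0) \<in> I"
        using that B by (auto simp: I_def)
      have "{z' \<in> Z. (x, z') \<in> I \<and> dist 0 z' = 1} = {z' \<in> Z. dist 0 z' = 1}"
        using that by (auto simp: I_def)
      then show ?thesis
        using deg[OF mem] Z(3) by (simp only: f0 S0 unit_degree_def add.commute)
    qed
    show "unit_degree T x = unit_degree S x" if "x \<in> S - B" for x
    proof -
      have mem: "(x, 0) \<in> I"
        using that by (auto simp: I_def)
      have "{z' \<in> Z. (x, z') \<in> I \<and> dist 0 z' = 1} = {}"
        using that by (auto simp: I_def)
      then show ?thesis
        using deg[OF mem] by (simp only: f0 S0 unit_degree_def card.empty add_0)
    qed
    show "unit_degree T x = d + r" if x: "x \<in> T - S" for x
    proof -
      from x obtain y z where yz: "x = f (y, z)" "(y, z) \<in> I"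
        by (auto simp: T_def)
      have z: "z \<noteq> 0"
        using x yz B by (auto simp: I_def f0)
      with yz have mem: "y \<in> B" "z \<in> Z"
        by (auto simp: I_def)
      have "{z' \<in> Z. (y, z') \<in> I \<and> dist z z' = 1} = {z' \<in> Z. dist z z' = 1}"
        using mem by (auto simp: I_def)
      \<comment> \<open>At a level \<open>z \<noteq> 0\<close> only the points over \<open>B\<close>
        are present, so the degree in the direction of \<open>S\<close> drops to that within
        \<open>B\<close>, which is \<open>r\<close>.\<close>
      moreover have "{y' \<in> S. (y', z) \<in> I \<and> dist y y' = 1} = {y' \<in> B. dist y y' = 1}"
        using mem z B by (auto simp: I_def)
      ultimately show ?thesis
        using deg[OF yz(2)] Z(4)[of z] r[of y] mem z by (simp add: yz(1) unit_degree_def)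
    qed
  qed
qed

text \<open>The case \<open>B = {v}\<close>, \<open>r = 0\<close>: one rotated gadget with its root
  placed at \<open>v\<close>.\<close>

lemma glue_gadget_at_vertex:
  assumes "finite S" "v \<in> S" "gadget d m"
  obtains T where "finite T" "S \<subseteq> T" "unit_degree T v = unit_degree S v + m"
    "\<And>x. x \<in> S - {v} \<Longrightarrow> unit_degree T x = unit_degree S x"
    "\<And>x. x \<in> T - S \<Longrightarrow> unit_degree T x = d"
proof -
  have "unit_degree {v} b = 0" if "b \<in> {v}" for b
    using that by (auto simp: unit_degree_def)
  moreover have "{v} \<subseteq> S"
    using assms by auto
  ultimately obtain T where "finite T" "S \<subseteq> T"
    "\<And>x. x \<in> {v} \<Longrightarrow> unit_degree T x = unit_degree S x + m"
    "\<And>x. x \<in> S - {v} \<Longrightarrow> unit_degree T x = unit_degree S x"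
    "\<And>x. x \<in> T - S \<Longrightarrow> unit_degree T x = d + 0"
    using assms glue_gadgets[of S "{v}" d m 0] by blast
  then show thesis
    by (intro that[of T]) auto
qed

text \<open>The case \<open>B = {v, w}\<close>, \<open>r = 1\<close>: the product of the gadget with
  an edge is attached, and the extra 1 in \<open>Suc d\<close> is the edge to the twin vertex in the
  other copy.\<close>

lemma glue_gadgets_along_edge:
  assumes "finite S" "v \<in> S" "w \<in> S" "dist v w = 1" "gadget d m"
  obtains T where "finite T" "S \<subseteq> T"
    "unit_degree T v = unit_degree S v + m" "unit_degree T w = unit_degree S w + m"
    "\<And>x. x \<in> S - {v, w} \<Longrightarrow> unit_degree T x = unit_degree S x"
    "\<And>x. x \<in> T - S \<Longrightarrow> unit_degree T x = Suc d"
proof -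
  have "{y \<in> {v, w}. dist v y = 1} = {w}" "{y \<in> {v, w}. dist w y = 1} = {v}"
    using assms(4) by (auto simp: dist_commute)
  then have "unit_degree {v, w} b = 1" if "b \<in> {v, w}" for b
    using that by (auto simp: unit_degree_def)
  moreover have "{v, w} \<subseteq> S"
    using assms by auto
  ultimately obtain T where "finite T" "S \<subseteq> T"
    "\<And>x. x \<in> {v, w} \<Longrightarrow> unit_degree T x = unit_degree S x + m"
    "\<And>x. x \<in> S - {v, w} \<Longrightarrow> unit_degree T x = unit_degree S x"
    "\<And>x. x \<in> T - S \<Longrightarrow> unit_degree T x = d + 1"
    using assms glue_gadgets[of S "{v, w}" d m 1] by blast
  then show thesis
    by (intro that[of T]) auto
qed

section \<open>Construction of gadgets\<close>

lemma gadget_0: "gadget d 0"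
  unfolding gadget_def by (intro exI[of _ "{0}"]) (auto simp: unit_degree_def)

text \<open>The second gadget is glued to the root of the first, so the two share their root and
  nothing else.\<close>

lemma gadget_add:
  assumes "gadget d m" "gadget d n"
  shows "gadget d (m + n)"
proof -
  from assms(1) obtain Z where Z: "finite Z" "0 \<in> Z" "unit_degree Z 0 = m"
    "\<And>z. z \<in> Z - {0} \<Longrightarrow> unit_degree Z z = d"
    unfolding gadget_def by blast
  from glue_gadget_at_vertex[OF Z(1,2) assms(2)] obtain T where T: "finite T" "Z \<subseteq> T"
    "unit_degree T 0 = m + n" "\<And>x. x \<in> Z - {0} \<Longrightarrow> unit_degree T x = unit_degree Z x"
    "\<And>x. x \<in> T - Z \<Longrightarrow> unit_degree T x = d"
    using Z(3) by metis
  then have "\<forall>x\<in>T - {0}. unit_degree T x = d"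
    using Z(4) by (metis Diff_iff)
  then show ?thesis
    unfolding gadget_def using T(1-3) Z(2) by (intro exI[of _ T]) auto
qed

lemma gadget_mult: "gadget d m \<Longrightarrow> gadget d (n * m)"
  by (induction n) (auto simp: gadget_0 gadget_add)

text \<open>In the single edge from 0 to 1, the gadget is glued to 1. This lifts the degree of 1 to
  \<open>Suc d\<close> and leaves 0 as a root of degree 1.\<close>

lemma gadget_pendant:
  assumes "gadget (Suc d) d"
  shows "gadget (Suc d) 1"
proof -
  have deg: "unit_degree {0, 1} 0 = 1" "unit_degree {0, 1} 1 = 1"
  proof -
    have "{y \<in> {0, 1}. dist 0 y = 1} = {1::complex}" "{y \<in> {0, 1}. dist 1 y = 1} = {0::complex}"
      by auto
    then show "unit_degree {0, 1} 0 = 1" "unit_degree {0, 1} 1 = 1"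
      by (simp_all add: unit_degree_def)
  qed
  obtain T where T: "finite T" "{0, 1} \<subseteq> T" "unit_degree T 1 = unit_degree {0, 1} 1 + d"
    "\<And>x. x \<in> {0, 1} - {1} \<Longrightarrow> unit_degree T x = unit_degree {0, 1} x"
    "\<And>x. x \<in> T - {0, 1} \<Longrightarrow> unit_degree T x = Suc d"
    using glue_gadget_at_vertex[of "{0, 1}" 1 "Suc d" d] assms by blast
  have "unit_degree T 0 = 1"
    using T(4)[of 0] deg by simp
  moreover have "\<forall>z\<in>T - {0}. unit_degree T z = Suc d"
    using T(3,5) deg by auto
  ultimately show ?thesis
    unfolding gadget_def using T(1,2) by (intro exI[of _ T]) auto
qed

text \<open>In a unit triangle with root 0, gluing along the opposite edge lifts its two ends from 2
  to \<open>n + 2\<close>, the same degree that the new vertices receive.\<close>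

lemma gadget_2_even:
  assumes "gadget (Suc n) n"
  shows "gadget (n + 2) 2"
proof -
  define a where "a = Complex (sqrt 3 / 2) (1 / 2)"
  define b where "b = Complex (sqrt 3 / 2) (- 1 / 2)"
  have d: "dist 0 a = 1" "dist 0 b = 1" "dist a b = 1"
    by (simp_all add: a_def b_def dist_norm cmod_def power2_eq_square field_simps)
  then have ne: "a \<noteq> 0" "b \<noteq> 0" "a \<noteq> b"
    by auto
  have "{y \<in> {0, a, b}. dist 0 y = 1} = {a, b}" "{y \<in> {0, a, b}. dist a y = 1} = {0, b}"
    "{y \<in> {0, a, b}. dist b y = 1} = {0, a}"
    using d by (auto simp: dist_commute)
  then have deg: "unit_degree {0, a, b} 0 = 2" "unit_degree {0, a, b} a = 2"
    "unit_degree {0, a, b} b = 2"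
    using ne by (simp_all add: unit_degree_def)
  obtain T where T: "finite T" "{0, a, b} \<subseteq> T"
    "unit_degree T a = unit_degree {0, a, b} a + n" "unit_degree T b = unit_degree {0, a, b} b + n"
    "\<And>x. x \<in> {0, a, b} - {a, b} \<Longrightarrow> unit_degree T x = unit_degree {0, a, b} x"
    "\<And>x. x \<in> T - {0, a, b} \<Longrightarrow> unit_degree T x = Suc (Suc n)"
    using glue_gadgets_along_edge[of "{0, a, b}" a b "Suc n" n] assms d(3) by blast
  have "unit_degree T 0 = 2"
    using T(5)[of 0] deg ne by simp
  moreover have "unit_degree T z = n + 2" if "z \<in> T - {0}" for z
    using T(3,4) deg T(6)[of z] that by (cases "z = a \<or> z = b") auto
  ultimately show ?thesis
    unfolding gadget_def using T(1,2) by (intro exI[of _ T]) auto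
qed

text \<open>A subdivided triangular prism: two unit triangles pointing towards each other, with bases
  on opposite sides of a unit square and their apexes joined through the origin. The origin has
  degree 2, every other vertex has degree 3, and these are perfectly matched.\<close>

lemma gadget_2_odd:
  assumes "gadget (n + 2) n"
  shows "gadget (n + 3) 2"
proof -
  \<comment> \<open>The triangle \<open>a\<close>, \<open>b\<close>, \<open>c\<close> has height
    \<open>h + 1/2 = sqrt 3 / 2\<close>, which determines \<open>h\<close>; then \<open>q\<close> is
    determined by \<open>q * q + h * h = 1\<close>, the unit distance from the origin to
    \<open>a\<close>.\<close>
  define q where "q = sqrt (sqrt 3 / 2)"
  define h where "h = (sqrt 3 - 1) / 2"
  define a where "a = Complex (- q) h"
  define a' where "a' = Complex (- q) (- h)"
  define b where "b = Complex (- q - 1/2) (- 1/2)"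
  define c where "c = Complex (- q + 1/2) (- 1/2)"
  define b' where "b' = Complex (- q - 1/2) (1/2)"
  define c' where "c' = Complex (- q + 1/2) (1/2)"
  note defs = a_def a'_def b_def c_def b'_def c'_def
  \<comment> \<open>The exact squares verify the ten edges; the rational bounds exclude unit
    distance for the other eleven pairs.\<close>
  have s3: "sqrt 3 * sqrt 3 = 3" "17/10 < sqrt 3" "sqrt 3 < 9/5"
    using real_less_rsqrt[of "17/10" 3] real_less_lsqrt[of "9/5" 3] by (auto simp: power2_eq_square)
  have q: "q * q = sqrt 3 / 2" "9/10 < q" "q < 1"
    using s3 real_less_rsqrt[of "9/10" "sqrt 3 / 2"] real_less_lsqrt[of 1 "sqrt 3 / 2"]
    by (auto simp: q_def power2_eq_square)
  have h: "h * h = 1 - sqrt 3 / 2" "7/20 < h" "h < 2/5"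
    using s3 by (auto simp: h_def field_simps)
  have dist1: "dist (Complex x y) (Complex x' y') = 1 \<longleftrightarrow> (x - x') * (x - x') + (y - y') * (y - y') = 1"
    for x y x' y'
    by (simp add: dist_norm cmod_def power2_eq_square)
  have zero: "0 = Complex 0 0"
    by (simp add: complex_eq_iff)
  have edge: "dist 0 a = 1" "dist 0 a' = 1" "dist a b = 1" "dist a c = 1" "dist a' b' = 1"
    "dist a' c' = 1" "dist b c = 1" "dist b' c' = 1" "dist b b' = 1" "dist c c' = 1"
    unfolding zero defs dist1 using q h s3 by (auto simp: h_def field_simps)
  have nonedge: "dist 0 b \<noteq> 1" "dist 0 c \<noteq> 1" "dist 0 b' \<noteq> 1" "dist 0 c' \<noteq> 1"
    "dist a a' \<noteq> 1" "dist a b' \<noteq> 1" "dist a c' \<noteq> 1" "dist a' b \<noteq> 1" "dist a' c \<noteq> 1"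
    "dist b c' \<noteq> 1" "dist c b' \<noteq> 1"
    unfolding zero defs dist1 using q h s3 by (auto simp: field_simps)
  have ne: "distinct [0, a, a', b, c, b', c']"
    unfolding zero defs using q h by auto
  define N where "N = {0, a, a', b, c, b', c'}"
  have "{y \<in> N. dist 0 y = 1} = {a, a'}" "{y \<in> N. dist a y = 1} = {0, b, c}"
    "{y \<in> N. dist a' y = 1} = {0, b', c'}" "{y \<in> N. dist b y = 1} = {a, c, b'}"
    "{y \<in> N. dist c y = 1} = {a, b, c'}" "{y \<in> N. dist b' y = 1} = {a', c', b}"
    "{y \<in> N. dist c' y = 1} = {a', b', c}"
    unfolding N_def using edge nonedge by (auto simp: dist_commute)
  then have deg: "unit_degree N 0 = 2" "unit_degree N a = 3" "unit_degree N a' = 3"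
    "unit_degree N b = 3" "unit_degree N c = 3" "unit_degree N b' = 3" "unit_degree N c' = 3"
    using ne by (auto simp: unit_degree_def)
  have N: "finite N" "a \<in> N" "b \<in> N"
    by (auto simp: N_def)
  \<comment> \<open>The matching consists of the pairs \<open>a b\<close>, \<open>c c'\<close> and
    \<open>a' b'\<close>. They are treated in turn; each gluing lifts one pair from 3 to
    \<open>n + 3\<close> and leaves the other old vertices alone.\<close>
  obtain T1 where T1: "finite T1" "N \<subseteq> T1"
    "unit_degree T1 a = unit_degree N a + n" "unit_degree T1 b = unit_degree N b + n"
    "\<And>x. x \<in> N - {a, b} \<Longrightarrow> unit_degree T1 x = unit_degree N x"
    "\<And>x. x \<in> T1 - N \<Longrightarrow> unit_degree T1 x = Suc (n + 2)"
    using glue_gadgets_along_edge[OF N edge(3) assms] by blast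
  have T1': "c \<in> T1" "c' \<in> T1" "unit_degree T1 c = 3" "unit_degree T1 c' = 3"
    using T1(2) T1(5)[of c] T1(5)[of c'] deg ne by (auto simp: N_def)
  obtain T2 where T2: "finite T2" "T1 \<subseteq> T2"
    "unit_degree T2 c = unit_degree T1 c + n" "unit_degree T2 c' = unit_degree T1 c' + n"
    "\<And>x. x \<in> T1 - {c, c'} \<Longrightarrow> unit_degree T2 x = unit_degree T1 x"
    "\<And>x. x \<in> T2 - T1 \<Longrightarrow> unit_degree T2 x = Suc (n + 2)"
    using glue_gadgets_along_edge[OF T1(1) T1'(1,2) edge(10) assms] by blast
  have T2': "a' \<in> T2" "b' \<in> T2" "unit_degree T2 a' = 3" "unit_degree T2 b' = 3"
    using T1(2) T2(2) T2(5)[of a'] T2(5)[of b'] T1(5)[of a'] T1(5)[of b'] deg ne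
    by (auto simp: N_def)
  obtain T3 where T3: "finite T3" "T2 \<subseteq> T3"
    "unit_degree T3 a' = unit_degree T2 a' + n" "unit_degree T3 b' = unit_degree T2 b' + n"
    "\<And>x. x \<in> T2 - {a', b'} \<Longrightarrow> unit_degree T3 x = unit_degree T2 x"
    "\<And>x. x \<in> T3 - T2 \<Longrightarrow> unit_degree T3 x = Suc (n + 2)"
    using glue_gadgets_along_edge[OF T2(1) T2'(1,2) edge(5) assms] by blast
  have "0 \<in> N" "0 \<in> T1" "0 \<in> T2" "0 \<in> T3"
    using T1(2) T2(2) T3(2) by (auto simp: N_def)
  moreover from this have "unit_degree T3 0 = 2"
    using T1(5)[of 0] T2(5)[of 0] T3(5)[of 0] deg(1) ne by auto
  moreover have "unit_degree T3 x = n + 3" if "x \<in> T3 - {0}" for x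
  proof -
    \<comment> \<open>After each stage the degree is right except at the root and at the pairs still
      to be treated.\<close>
    have 1: "unit_degree T1 x = n + 3" if "x \<in> T1 - {0, c, c', a', b'}"
      using T1(3,4) deg T1(6)[of x] that by (cases "x \<in> N") (auto simp: N_def)
    have 2: "unit_degree T2 x = n + 3" if "x \<in> T2 - {0, a', b'}"
      using T2(3,4) T1'(3,4) T2(5,6)[of x] 1 that by (cases "x \<in> T1"; cases "x = c \<or> x = c'") auto
    show ?thesis
      using T3(3,4) T2'(3,4) T3(5,6)[of x] 2 that by (cases "x \<in> T2"; cases "x = a' \<or> x = b'") auto
  qed
  ultimately show ?thesis
    unfolding gadget_def using T3(1) by (intro exI[of _ T3]) auto
qed

text \<open>The induction passes from \<open>2 * k + 1\<close> through the even degree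
  \<open>2 * k + 2\<close> to \<open>2 * k + 3\<close>. By the handshake lemma a gadget for even
  \<open>d\<close> has an even root degree, so arbitrary \<open>m\<close> can be expected only for
  odd \<open>d\<close>.\<close>

lemma gadget_odd: "gadget (2 * k + 1) m"
proof (induction k arbitrary: m)
  case 0
  have "gadget (Suc 0) 1"
    by (rule gadget_pendant) (rule gadget_0)
  then show ?case
    using gadget_mult[of 1 1 m] by simp
next
  case (Suc k)
  have "gadget (2 * k + 2) 2"
    using Suc.IH[of "2 * k"] by (intro gadget_2_even) simp
  then have "gadget (2 * k + 2) (2 * k)"
    using gadget_mult[of "2 * k + 2" 2 k] by (simp add: mult.commute)
  then have "gadget (2 * k + 3) 2"
    by (rule gadget_2_odd)
  then have "gadget (2 * k + 3) (2 * k + 2)"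
    using gadget_mult[of "2 * k + 3" 2 "k + 1"] by (simp add: algebra_simps)
  then have "gadget (2 * k + 3) 1"
    using gadget_pendant[of "2 * k + 2"] by (simp add: numeral_3_eq_3)
  then show ?case
    using gadget_mult[of "2 * k + 3" 1 m] by (simp add: numeral_3_eq_3)
qed

section \<open>Extension of finite point sets to regular ones\<close>

text \<open>Induction on the number of deficient vertices: a gadget with the missing root degree
  repairs one of them, and its new vertices are not deficient.\<close>

lemma extend_to_regular:
  assumes "finite S" "\<And>x. x \<in> S \<Longrightarrow> unit_degree S x \<le> 2 * k + 1"
  shows "\<exists>T. finite T \<and> S \<subseteq> T \<and> (\<forall>x\<in>T. unit_degree T x = 2 * k + 1)"
  using assms
proof (induction "card {x \<in> S. unit_degree S x \<noteq> 2 * k + 1}" arbitrary: S rule: less_induct)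
  case less
  let ?D = "\<lambda>S. {x \<in> S. unit_degree S x \<noteq> 2 * k + 1}"
  show ?case
  proof (cases "?D S = {}")
    case True
    then show ?thesis
      using less.prems by (intro exI[of _ S]) auto
  next
    case False
    then obtain v where v: "v \<in> S" "unit_degree S v \<noteq> 2 * k + 1"
      by auto
    obtain T where T: "finite T" "S \<subseteq> T"
      "unit_degree T v = unit_degree S v + (2 * k + 1 - unit_degree S v)"
      "\<And>x. x \<in> S - {v} \<Longrightarrow> unit_degree T x = unit_degree S x"
      "\<And>x. x \<in> T - S \<Longrightarrow> unit_degree T x = 2 * k + 1"
      using glue_gadget_at_vertex[OF less.prems(1) v(1) gadget_odd] by metis
    \<comment> \<open>The degree bound makes the truncated subtraction exact.\<close>
    have Tv: "unit_degree T v = 2 * k + 1"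
      using T(3) less.prems(2)[OF v(1)] by simp
    have T_cases: "unit_degree T x = 2 * k + 1 \<or> x \<in> S - {v} \<and> unit_degree T x = unit_degree S x"
      if "x \<in> T" for x
      using Tv T(4,5)[of x] that by blast
    have "?D T \<subseteq> ?D S - {v}"
    proof
      fix x assume "x \<in> ?D T"
      then show "x \<in> ?D S - {v}"
        using T_cases[of x] by auto
    qed
    then have "?D T \<subset> ?D S"
      using v by blast
    then have "card (?D T) < card (?D S)"
      using less.prems(1) by (intro psubset_card_mono) auto
    moreover have "unit_degree T x \<le> 2 * k + 1" if "x \<in> T" for x
      using T_cases[OF that] less.prems(2)[of x] by auto
    ultimately obtain T' where "finite T'" "T \<subseteq> T'" "\<forall>x\<in>T'. unit_degree T' x = 2 * k + 1"
      using less.hyps[of T] T(1) by blast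
    then show ?thesis
      using T(2) by blast
  qed
qed

text \<open>The result for \<open>complex\<close> is carried over by the isometry \<open>g\<close>,
  a left inverse of \<open>f\<close>.\<close>

lemma finite_plane_set_extends_to_regular:
  fixes S :: "(real ^ 2) set"
  assumes "finite S"
  shows "\<exists>T n. finite T \<and> S \<subseteq> T \<and> (\<forall>x\<in>T. card {y \<in> T. dist x y = 1} = n)"
proof -
  define f :: "real ^ 2 \<Rightarrow> complex" where "f x = Complex (x $ 1) (x $ 2)" for x
  define g :: "complex \<Rightarrow> real ^ 2" where "g z = vector [Re z, Im z]" for z
  have gf: "g (f x) = x" for x
    by (simp add: f_def g_def vec_eq_iff forall_2)
  have dist_g: "dist (g z) (g w) = dist z w" for z w
    by (simp add: g_def dist_vec_def L2_set_def sum_2 dist_real_def dist_norm cmod_def)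
  then have inj_g: "inj g"
    by (metis dist_eq_0_iff injI)
  \<comment> \<open>The target degree has to be odd and at least every degree in the set; twice the
    number of points plus one is a crude choice.\<close>
  have "unit_degree (f ` S) x \<le> 2 * card (f ` S) + 1" for x
    using card_mono[of "f ` S" "{y \<in> f ` S. dist x y = 1}"] assms by (simp add: unit_degree_def)
  then obtain T where T: "finite T" "f ` S \<subseteq> T"
    "\<And>x. x \<in> T \<Longrightarrow> unit_degree T x = 2 * card (f ` S) + 1"
    using extend_to_regular[of "f ` S" "card (f ` S)"] assms by blast
  have "card {y \<in> g ` T. dist (g z) y = 1} = unit_degree T z" for z
  proof -
    have "{y \<in> g ` T. dist (g z) y = 1} = g ` {y \<in> T. dist z y = 1}"
      by (auto simp: dist_g)
    then show ?thesis
      using inj_g by (simp add: unit_degree_def card_image inj_on_subset)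
  qed
  moreover have "S \<subseteq> g ` T"
    using T(2) gf by (metis image_eqI image_subset_iff subsetI)
  ultimately show ?thesis
    using T by (intro exI[of _ "g ` T"] exI[of _ "2 * card (f ` S) + 1"]) auto
qed

section \<open>From point sets to graphs\<close>

definition unit_graph :: "(real ^ 2) set \<Rightarrow> (real ^ 2) ugraph" where
  "unit_graph T = \<lparr>verts = T, edges = {e \<in> edges unit_distance_plane. e \<subseteq> T}\<rparr>"

lemma verts_unit_graph [simp]: "verts (unit_graph T) = T"
  by (simp add: unit_graph_def)

lemma adjacent_unit_graph:
  "x \<in> T \<Longrightarrow> y \<in> T \<Longrightarrow> adjacent (unit_graph T) x y \<longleftrightarrow> dist x y = 1"
  using adjacent_unit_distance_plane[of x y] by (auto simp: unit_graph_def adjacent_def)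

lemma simple_unit_graph: "simple_graph (unit_graph T)"
  using simple_graph_unit_distance_plane by (auto simp: simple_graph_def unit_graph_def)

lemma induced_unit_distance_unit_graph: "induced_unit_distance_graph (unit_graph T)"
  unfolding induced_unit_distance_graph_iff_drawing
  by (intro conjI simple_unit_graph exI[of _ "\<lambda>x. x"]) (auto simp: adjacent_unit_graph)

lemma neighbours_unit_graph: "x \<in> T \<Longrightarrow> neighbours (unit_graph T) x = {y \<in> T. dist x y = 1}"
  by (auto simp: neighbours_def adjacent_unit_graph)

text \<open>A translation maps one circle onto the other. This makes the whole plane regular, where
  the degrees are infinite and compared as cardinals.\<close>

lemma unit_spheres_eqpoll: "{y. dist x y = 1} \<approx> {y. dist x' y = 1}" for x x' :: "real ^ 2"
proof -
  have "bij_betw (\<lambda>y. y + (x' - x)) {y. dist x y = 1} {y. dist x' y = 1}"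
    by (rule bij_betw_byWitness[where f' = "\<lambda>y. y - (x' - x)"]) (auto simp: dist_norm algebra_simps)
  then show ?thesis
    by (auto simp: eqpoll_def)
qed

theorem theorem2p3:
  fixes G :: "'a ugraph"
  assumes "induced_unit_distance_graph G"
  shows "\<exists>H :: (real ^ 2) ugraph.
           induced_unit_distance_graph H \<and> regular_graph H \<and>
           (finite (verts G) \<longrightarrow> finite (verts H)) \<and>
           (\<exists>K. subgraph K H \<and> isomorphic_graphs G K)"
proof -
  from assms obtain p :: "'a \<Rightarrow> real ^ 2" where p: "inj_on p (verts G)"
    "\<forall>u\<in>verts G. \<forall>v\<in>verts G. dist (p u) (p v) = 1 \<longleftrightarrow> adjacent G u v"
    unfolding induced_unit_distance_graph_iff_drawing by blast
  define S where "S = p ` verts G"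
  have "isomorphic_graphs G (unit_graph S)"
    unfolding isomorphic_graphs_def using p
    by (intro exI[of _ p]) (auto simp: S_def bij_betw_def adjacent_unit_graph)
  moreover have "subgraph (unit_graph S) (unit_graph T)" if "S \<subseteq> T" for T
    using that simple_unit_graph[of S] by (auto simp: subgraph_def unit_graph_def)
  \<comment> \<open>What remains is the choice of the vertex set \<open>T\<close> of
    \<open>H\<close> around the drawing \<open>S\<close>.\<close>
  moreover have "\<exists>T. S \<subseteq> T \<and> regular_graph (unit_graph T) \<and> (finite (verts G) \<longrightarrow> finite T)"
  proof (cases "finite (verts G)")
    case True
    then obtain T n where T: "finite T" "S \<subseteq> T" "\<And>x. x \<in> T \<Longrightarrow> card {y \<in> T. dist x y = 1} = n"
      using finite_plane_set_extends_to_regular[of S] by (auto simp: S_def)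
    then have "regular_graph (unit_graph T)"
      by (auto simp: regular_graph_def neighbours_unit_graph eqpoll_iff_card)
    with T show ?thesis
      by blast
  next
    case False
    have "regular_graph (unit_graph UNIV)"
      by (simp add: regular_graph_def neighbours_unit_graph unit_spheres_eqpoll)
    with False show ?thesis
      by blast
  qed
  ultimately show ?thesis
    using induced_unit_distance_unit_graph by (metis verts_unit_graph)
qed

end
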